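(* Let $V$ be a finite set, $K$ a Markov kernel on $V$, and $g:V\to V$ a bijection. For $i=1,2,\dots$ set $K_i(x,y)=K(g^{i-1}x,g^{i-1}y)$, and set $\widetilde K(x,y)=K(x,g^{-1}y)$, $x,y\in V$. (1) The sequence $(K_i)_1^\infty$ is merging in relative-sup if and only if the kernel $\widetilde K$ is irreducible and aperiodic. (2) If $\widetilde K$ is irreducible and aperiodic, let $\widetilde\pi$ be its unique invariant probability measure and set $\mu_i(x)=\widetilde\pi(g^i x)$, $x\in V$. Then for all $n\ge 1$ and all $x,z\in V$, $$\left|\frac{K_{0,n}(x,z)}{\mu_n(z)}-1\right|\le \left(\frac{1}{\widetilde\pi(x)}-1\right)^{1/2}\left(\frac{1}{\widetilde\pi(g^n z)}-1\right)^{1/2}\widetilde\sigma_1^{\,n},$$ where $\widetilde\sigma_1$ is the second largest singular value of $\widetilde K$ acting on $\ell^2(\widetilde\pi)$.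
   Context: A Markov kernel on $V$ is a nonnegative function $K(x,y)$ on $V\times V$ with $\sum_y K(x,y)=1$ for all $x$. For a sequence $(K_i)_1^\infty$ of Markov kernels, $K_{0,0}=I$ and $K_{0,n}(x,y)=\sum_z K_{0,n-1}(x,z)K_n(z,y)$, i.e. $K_{0,n}=K_1K_2\cdots K_n$. The sequence is merging in relative-sup if $$\max_{x,y,z\in V}\left|\frac{K_{0,n}(x,z)}{K_{0,n}(y,z)}-1\right|\to 0\quad\text{as } n\to\infty,$$ where this maximum is taken to be $+\infty$ whenever $K_{0,n}(y,z)=0$ for some $y,z$ (so merging in relative-sup requires all entries of $K_{0,n}$ to be positive for all large $n$). A kernel acts on functions by $\widetilde Kf(x)=\sum_y\widetilde K(x,y)f(y)$; $\ell^2(\widetilde\pi)$ is the space of functions on $V$ with inner product $\langle f,h\rangle=\sum_x f(x)h(x)\widetilde\pi(x)$. Singular values of $\widetilde K$ on $\ell^2(\widetilde\pi)$ are the square roots of the eigenvalues of $\widetilde K^*\widetilde K$ ($\widetilde K^*$ the adjoint on $\ell^2(\widetilde\pi)$), listed in nonincreasing order with multiplicity: $1=\widetilde\sigma_0\ge\widetilde\sigma_1\ge\cdots\ge\widetilde\sigma_{|V|-1}$. *)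

theory Defs
  imports "HOL-Analysis.Analysis" "HOL-Library.Multiset"
begin

text \<open>
  The finite set \<open>V\<close> is the finite type \<open>'v\<close>. Kernels are matrices \<open>K :: real^'v^'v\<close> with
  \<open>K $ x $ y\<close> for \<open>K(x,y)\<close>, functions and measures on \<open>V\<close> are vectors \<open>real^'v\<close>. Thus \<open>**\<close> is the
  composition of kernels, \<open>K *v f\<close> the action on functions and \<open>p v* K\<close> the action on measures.
\<close>

definition markov_kernel :: "real^'v^'v \<Rightarrow> bool" where
  "markov_kernel K \<longleftrightarrow> (\<forall>x y. 0 \<le> K $ x $ y) \<and> (\<forall>x. (\<Sum>y\<in>UNIV. K $ x $ y) = 1)"

text \<open>Sequences of kernels are indexed from 1; the value \<open>Ks 0\<close> is never used.\<close>

primrec kernel_prod :: "(nat \<Rightarrow> real^'v^'v) \<Rightarrow> nat \<Rightarrow> real^'v^'v" where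
  "kernel_prod Ks 0 = mat 1"
| "kernel_prod Ks (Suc n) = kernel_prod Ks n ** Ks (Suc n)"

definition kernel_power :: "real^'v^'v \<Rightarrow> nat \<Rightarrow> real^'v^'v" where
  "kernel_power K = kernel_prod (\<lambda>_. K)"

definition rel_sup_dist :: "real^'v^'v \<Rightarrow> ereal" where
  "rel_sup_dist P =
     (if \<exists>y z. P $ y $ z = 0 then \<infinity>
      else ereal (MAX (x, y, z)\<in>UNIV. \<bar>P $ x $ z / P $ y $ z - 1\<bar>))"

definition merging_rel_sup :: "(nat \<Rightarrow> real^'v^'v) \<Rightarrow> bool" where
  "merging_rel_sup Ks \<longleftrightarrow> (\<lambda>n. rel_sup_dist (kernel_prod Ks n)) \<longlonglongrightarrow> 0"

definition irreducible_kernel :: "real^'v^'v \<Rightarrow> bool" where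
  "irreducible_kernel K \<longleftrightarrow> (\<forall>x y. \<exists>n. kernel_power K n $ x $ y > 0)"

definition aperiodic_kernel :: "real^'v^'v \<Rightarrow> bool" where
  "aperiodic_kernel K \<longleftrightarrow> (\<forall>x. Gcd {n. n \<ge> 1 \<and> kernel_power K n $ x $ x > 0} = 1)"

definition invariant_prob :: "real^'v^'v \<Rightarrow> real^'v \<Rightarrow> bool" where
  "invariant_prob K p \<longleftrightarrow> (\<forall>x. 0 \<le> p $ x) \<and> (\<Sum>x\<in>UNIV. p $ x) = 1 \<and> p v* K = p"

definition l2_inner :: "real^'v \<Rightarrow> real^'v \<Rightarrow> real^'v \<Rightarrow> real" where
  "l2_inner p f h = (\<Sum>x\<in>UNIV. f $ x * h $ x * p $ x)"

text \<open>The adjoint is uniquely determined whenever \<open>p\<close> is everywhere positive.\<close>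

definition l2_adjoint :: "real^'v \<Rightarrow> (real^'v \<Rightarrow> real^'v) \<Rightarrow> (real^'v \<Rightarrow> real^'v)" where
  "l2_adjoint p T = (THE S. \<forall>f h. l2_inner p (T f) h = l2_inner p f (S h))"

definition eigenspace :: "(real^'v \<Rightarrow> real^'v) \<Rightarrow> real \<Rightarrow> (real^'v) set" where
  "eigenspace T c = {f. T f = c *\<^sub>R f}"

definition eigenvalues :: "(real^'v \<Rightarrow> real^'v) \<Rightarrow> real set" where
  "eigenvalues T = {c. \<exists>f. f \<noteq> 0 \<and> T f = c *\<^sub>R f}"

text \<open>
  Only self-adjoint operators on \<open>\<ell>\<^sup>2(p)\<close> are considered below, so all eigenvalues are real and the
  multiplicity of an eigenvalue is the dimension of its eigenspace.
\<close>

definition eigenvalue_mset :: "(real^'v \<Rightarrow> real^'v) \<Rightarrow> real multiset" where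
  "eigenvalue_mset T = (\<Sum>c\<in>eigenvalues T. replicate_mset (dim (eigenspace T c)) c)"

text \<open>
  The singular values on \<open>\<ell>\<^sup>2(p)\<close>, in nonincreasing order with multiplicity; \<open>singular_values p K ! j\<close>
  is \<open>\<sigma>\<^sub>j\<close> for \<open>j < |V|\<close>.
\<close>

definition singular_values :: "real^'v \<Rightarrow> real^'v^'v \<Rightarrow> real list" where
  "singular_values p K =
     rev (sorted_list_of_multiset
       (image_mset sqrt (eigenvalue_mset (l2_adjoint p ((*v) K) \<circ> (*v) K))))"

end

theory Submission
  imports Defs
begin

text \<open>
  Since \<open>K(g\<^sup>i\<^sup>-\<^sup>1 x, g\<^sup>i\<^sup>-\<^sup>1 y) = Kt(g\<^sup>i\<^sup>-\<^sup>1 x, g\<^sup>i y)\<close>, the product telescopes to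
  \<open>K\<^sub>0\<^sub>,\<^sub>n(x, z) = Kt\<^sup>n(x, g\<^sup>n z)\<close>. Permuting columns does not change the relative-sup distance, so
  everything reduces to powers of \<open>Kt\<close>. If \<open>Kt\<close> is irreducible and aperiodic, some power is positive
  and contracts the oscillation of every function, so all rows converge to a common positive
  invariant measure. For the quantitative bound, \<open>Kt\<close> acts on the functions orthogonal to the
  constants with norm at most \<open>\<sigma>\<^sub>1\<close>: the square of its norm there is an eigenvalue of \<open>Kt\<^sup>* Kt\<close> with
  an eigenvector orthogonal to the eigenvector \<open>1\<close>.
\<close>

subsection \<open>Positivity of kernel powers\<close>

text \<open>The least positive difference \<open>d\<close> of two elements divides every element, so
  \<open>d = 1\<close>. Then \<open>S\<close> contains two consecutive numbers \<open>b\<close> and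
  \<open>b + 1\<close>, whose combinations reach everything from \<open>b * b\<close> on.\<close>

lemma additive_Gcd_1_eventually:
  fixes S :: "nat set"
  assumes zero: "0 \<in> S" and add: "\<And>a b. a \<in> S \<Longrightarrow> b \<in> S \<Longrightarrow> a + b \<in> S" and Gcd: "Gcd S = 1"
  obtains N where "\<And>n. n \<ge> N \<Longrightarrow> n \<in> S"
proof -
  have mult: "k * a \<in> S" if "a \<in> S" for k a
    by (induction k) (auto simp: zero add that)
  have "S \<noteq> {} \<and> \<not> S \<subseteq> {0}"
    using Gcd zero by (metis Gcd_0_iff empty_iff zero_neq_one)
  then obtain s where s: "s \<in> S" "s > 0" by auto
  define P where "P d \<longleftrightarrow> d > 0 \<and> (\<exists>b\<in>S. b + d \<in> S)" for d
  define d where "d = (LEAST d. P d)"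
  have "P s" using s zero unfolding P_def by force
  then have "P d" unfolding d_def by (rule LeastI)
  then obtain b where b: "d > 0" "b \<in> S" "b + d \<in> S" unfolding P_def by auto
  have "d dvd t" if t: "t \<in> S" for t
  proof (rule ccontr)
    assume "\<not> d dvd t"
    then have r: "t mod d > 0" by (simp add: mod_greater_zero_iff_not_dvd)
    define q where "q = t div d"
    \<comment> \<open>Both \<open>q * (b + d)\<close> and \<open>t + q * b\<close> lie in
      \<open>S\<close> and differ by \<open>t mod d\<close>, a positive difference below the least
      one.\<close>
    have "q * (b + d) + t mod d = t + q * b"
      unfolding q_def by (simp add: algebra_simps)
    then have "P (t mod d)"
      unfolding P_def using r mult[OF b(3), of q] add[OF t mult[OF b(2), of q]] by metis
    then have "d \<le> t mod d" unfolding d_def by (rule Least_le)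
    with b(1) show False using mod_less_divisor leD by blast
  qed
  then have "d dvd Gcd S" by (simp add: Gcd_greatest)
  with Gcd have d1: "d = 1" by simp
  \<comment> \<open>For \<open>n = q * b + r\<close> with \<open>r < b \<le> q\<close>, trade
    \<open>r\<close> of the \<open>q\<close> copies of \<open>b\<close> for copies of
    \<open>b + 1\<close>.\<close>
  have "n \<in> S" if n: "n \<ge> b * b" for n
  proof (cases "b = 0")
    case True
    then show ?thesis using mult[OF b(3), of n] d1 by simp
  next
    case False
    define q r where "q = n div b" and "r = n mod b"
    have nqr: "n = q * b + r" by (simp add: q_def r_def)
    have "r < b" using False by (simp add: r_def)
    moreover have "b \<le> q"
      using n False by (simp add: q_def less_eq_div_iff_mult_less_eq)
    ultimately have "r \<le> q" by simp
    then obtain c where "q = r + c" using le_Suc_ex by blast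
    then have "n = c * b + r * (b + d)" using nqr d1 by (simp add: algebra_simps)
    then show ?thesis using add[OF mult[OF b(2)] mult[OF b(3)]] by simp
  qed
  then show thesis using that by blast
qed

lemma kernel_power_0 [simp]: "kernel_power K 0 = mat 1"
  and kernel_power_Suc: "kernel_power K (Suc n) = kernel_power K n ** K"
  by (simp_all add: kernel_power_def)

lemma kernel_power_add: "kernel_power K (m + n) = kernel_power K m ** kernel_power K n"
  by (induction n) (simp_all add: kernel_power_Suc matrix_mul_assoc)

lemma matrix_mult_component:
  "(A ** B) $ x $ z = (\<Sum>y\<in>UNIV. A $ x $ y * B $ y $ z)"
  by (simp add: matrix_matrix_mult_def)

lemma markov_kernel_nonneg: "markov_kernel K \<Longrightarrow> 0 \<le> K $ x $ y"
  and markov_kernel_sum: "markov_kernel K \<Longrightarrow> (\<Sum>y\<in>UNIV. K $ x $ y) = 1"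
  by (simp_all add: markov_kernel_def)

lemma markov_kernel_mult:
  assumes A: "markov_kernel A" and B: "markov_kernel B"
  shows "markov_kernel (A ** B)"
proof -
  have "(\<Sum>z\<in>UNIV. \<Sum>y\<in>UNIV. A $ x $ y * B $ y $ z) = 1" for x
    by (subst sum.swap) (simp add: sum_distrib_left[symmetric] markov_kernel_sum A B)
  then show ?thesis using assms
    by (auto simp: markov_kernel_def matrix_mult_component intro!: sum_nonneg mult_nonneg_nonneg)
qed

lemma markov_kernel_power: "markov_kernel K \<Longrightarrow> markov_kernel (kernel_power K n)"
proof (induction n)
  case 0
  then show ?case by (simp add: markov_kernel_def mat_def)
next
  case (Suc n)
  then show ?case by (simp add: kernel_power_Suc markov_kernel_mult)
qed

lemma kernel_power_pos_mult:
  assumes "markov_kernel K" "kernel_power K m $ x $ y > 0" "kernel_power K n $ y $ z > 0"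
  shows "kernel_power K (m + n) $ x $ z > 0"
  unfolding kernel_power_add matrix_mult_component
  by (rule sum_pos2[of _ y])
    (use assms in \<open>auto intro!: mult_nonneg_nonneg markov_kernel_nonneg markov_kernel_power\<close>)

text \<open>Return times to \<open>x\<close> are closed under addition and have gcd 1, so all large
  ones occur. A fixed path of length \<open>m x y\<close> then leads from \<open>x\<close> to
  \<open>y\<close>; finiteness of the state space makes the threshold uniform.\<close>

lemma irreducible_aperiodic_imp_eventually_pos:
  fixes K :: "real^'v^'v"
  assumes K: "markov_kernel K" and irr: "irreducible_kernel K" and aper: "aperiodic_kernel K"
  obtains N where "\<And>n x y. n \<ge> N \<Longrightarrow> kernel_power K n $ x $ y > 0"
proof -
  have "\<exists>N. \<forall>n\<ge>N. kernel_power K n $ x $ x > 0" for x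
  proof -
    let ?S = "{n. kernel_power K n $ x $ x > 0}"
    have "Gcd {n. n \<ge> 1 \<and> kernel_power K n $ x $ x > 0} = 1"
      using aper by (simp add: aperiodic_kernel_def)
    \<comment> \<open>Time 0 makes the return times a monoid and leaves their gcd unchanged.\<close>
    moreover have "?S = insert 0 {n. n \<ge> 1 \<and> kernel_power K n $ x $ x > 0}"
      by (auto simp: mat_def Suc_le_eq)
    ultimately have "Gcd ?S = 1" by simp
    moreover have "0 \<in> ?S" by (simp add: mat_def)
    moreover have "a + b \<in> ?S" if "a \<in> ?S" "b \<in> ?S" for a b
      using that kernel_power_pos_mult[OF K] by simp
    ultimately obtain N where "\<And>n. n \<ge> N \<Longrightarrow> n \<in> ?S"
      by (elim additive_Gcd_1_eventually) blast+
    then show ?thesis by blast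
  qed
  then obtain N where N: "\<And>n x. n \<ge> N x \<Longrightarrow> kernel_power K n $ x $ x > 0" by metis
  define m where "m x y = (SOME n. kernel_power K n $ x $ y > 0)" for x y
  have m: "kernel_power K (m x y) $ x $ y > 0" for x y
    unfolding m_def by (rule someI_ex) (use irr in \<open>simp add: irreducible_kernel_def\<close>)
  define M where "M = (\<Sum>x\<in>UNIV. N x + (\<Sum>y\<in>UNIV. m x y))"
  have "kernel_power K n $ x $ y > 0" if "n \<ge> M" for n x y
  proof -
    have "m x y \<le> (\<Sum>y\<in>UNIV. m x y)" by (rule member_le_sum) auto
    moreover have "N x + (\<Sum>y\<in>UNIV. m x y) \<le> M"
      unfolding M_def by (rule member_le_sum) auto
    ultimately have n: "n = (n - m x y) + m x y" "n - m x y \<ge> N x" using that by linarith+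
    show ?thesis using kernel_power_pos_mult[OF K N[OF n(2)] m[of x y]] n(1) by metis
  qed
  then show thesis using that by blast
qed

lemma eventually_pos_imp_irreducible_aperiodic:
  assumes pos: "\<And>n x y. n \<ge> N \<Longrightarrow> kernel_power K n $ x $ y > 0"
  shows "irreducible_kernel K" "aperiodic_kernel K"
proof -
  show "irreducible_kernel K" using pos unfolding irreducible_kernel_def by blast
  show "aperiodic_kernel K" unfolding aperiodic_kernel_def
  proof
    fix x
    let ?S = "{n. n \<ge> 1 \<and> kernel_power K n $ x $ x > 0}"
    \<comment> \<open>Two consecutive return times force the period to be 1.\<close>
    have "Gcd ?S dvd Suc N" "Gcd ?S dvd Suc (Suc N)"
      by (intro Gcd_dvd; use pos in simp)+
    then have "Gcd ?S dvd Suc (Suc N) - Suc N" by (rule dvd_diff_nat[rotated])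
    then show "Gcd ?S = 1" by simp
  qed
qed

subsection \<open>Convergence to the invariant measure\<close>

lemma markov_kernel_mult_vector_le:
  assumes "markov_kernel P" and "\<And>y. f $ y \<le> M"
  shows "(P *v f) $ x \<le> M"
proof -
  have "(P *v f) $ x \<le> (\<Sum>y\<in>UNIV. P $ x $ y * M)"
    unfolding matrix_vector_mult_def
    by (auto intro!: sum_mono mult_left_mono assms markov_kernel_nonneg)
  then show ?thesis by (simp add: sum_distrib_right[symmetric] markov_kernel_sum assms)
qed

lemma markov_kernel_mult_vector_ge:
  assumes "markov_kernel P" and "\<And>y. m \<le> f $ y"
  shows "m \<le> (P *v f) $ x"
proof -
  have "(\<Sum>y\<in>UNIV. P $ x $ y * m) \<le> (P *v f) $ x"
    unfolding matrix_vector_mult_def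
    by (auto intro!: sum_mono mult_left_mono assms markov_kernel_nonneg)
  then show ?thesis by (simp add: sum_distrib_right[symmetric] markov_kernel_sum assms)
qed

text \<open>All terms of the average of \<open>M - f\<close> are nonnegative, so it is at least its
  term at \<open>y\<close>. Taking \<open>y\<close> to minimise \<open>f\<close> makes the gain
  proportional to the oscillation.\<close>

lemma doeblin_upper_bound:
  assumes P: "markov_kernel P" and d: "\<delta> \<le> P $ x $ y" and M: "\<And>w. f $ w \<le> M"
  shows "(P *v f) $ x \<le> M - \<delta> * (M - f $ y)"
proof -
  have "\<delta> * (M - f $ y) \<le> P $ x $ y * (M - f $ y)"
    using d M by (intro mult_right_mono) auto
  also have "\<dots> \<le> (\<Sum>w\<in>UNIV. P $ x $ w * (M - f $ w))"
    by (rule member_le_sum) (use P M in \<open>auto intro!: mult_nonneg_nonneg simp: markov_kernel_nonneg\<close>)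
  also have "\<dots> = M - (P *v f) $ x"
    by (simp add: matrix_vector_mult_def right_diff_distrib sum_subtractf
        sum_distrib_right[symmetric] markov_kernel_sum P)
  finally show ?thesis by simp
qed

text \<open>Averaging raises the minimum and lowers the maximum, so both converge; a strictly
  positive power contracts the gap and makes the limits equal. The second conclusion carries a lower
  bound at one time over to the limit, which later yields a positive limit measure.\<close>

lemma markov_kernel_power_converges:
  fixes K :: "real^'v^'v" and f :: "real^'v"
  assumes K: "markov_kernel K" and pos: "\<And>x y. kernel_power K N $ x $ y > 0"
  obtains c where "\<And>x. (\<lambda>n. (kernel_power K n *v f) $ x) \<longlonglongrightarrow> c"
    and "\<And>n m. (\<And>x. m \<le> (kernel_power K n *v f) $ x) \<Longrightarrow> m \<le> c"
proof -
  define F where "F n = kernel_power K n *v f" for n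
  define a where "a n = Min (range (\<lambda>x. F n $ x))" for n
  define b where "b n = Max (range (\<lambda>x. F n $ x))" for n
  have aF: "a n \<le> F n $ x" and Fb: "F n $ x \<le> b n" for n x
    by (auto simp: a_def b_def)
  have "a n \<in> range (\<lambda>x. F n $ x)" "b n \<in> range (\<lambda>x. F n $ x)" for n
    unfolding a_def b_def by (rule Min_in Max_in; simp)+
  then have "\<exists>x. a n = F n $ x" "\<exists>x. b n = F n $ x" for n by blast+
  then obtain x0 x1 where x0: "\<And>n. a n = F n $ x0 n" and x1: "\<And>n. b n = F n $ x1 n"
    by metis
  have F_add: "F (m + n) = kernel_power K m *v F n" for m n
    by (simp add: F_def kernel_power_add matrix_vector_mul_assoc)
  have le_a: "c \<le> a (m + n)" if "\<And>x. c \<le> F n $ x" for c m n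
    unfolding x0 F_add by (rule markov_kernel_mult_vector_ge[OF markov_kernel_power[OF K] that])
  have b_le: "b (m + n) \<le> b n" for m n
    unfolding x1[of "m + n"] F_add
    by (rule markov_kernel_mult_vector_le[OF markov_kernel_power[OF K] Fb])
  have inc: "incseq a" using le_a[OF aF] by (metis add.commute incseq_def le_iff_add)
  have dec: "decseq b" using b_le by (metis add.commute decseq_def le_iff_add)
  have ab: "a n \<le> b n" for n using aF Fb by (rule order_trans)
  have bounds: "a n \<le> b 0" "a 0 \<le> b n" for n
    using order_trans[OF ab decseqD[OF dec le0]] order_trans[OF incseqD[OF inc le0] ab] .
  obtain A where A: "a \<longlonglongrightarrow> A"
    by (rule incseq_convergent[OF inc, of "b 0"]) (simp_all add: bounds)
  obtain B where B: "b \<longlonglongrightarrow> B"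
    by (rule decseq_convergent[OF dec, of "a 0"]) (simp_all add: bounds)
  define \<delta> where "\<delta> = Min (range (\<lambda>(x, y). kernel_power K N $ x $ y))"
  have \<delta>: "\<delta> \<le> kernel_power K N $ x $ y" for x y
    unfolding \<delta>_def by (rule Min_le) (simp, rule range_eqI[of _ _ "(x, y)"], simp)
  have \<delta>_pos: "\<delta> > 0" unfolding \<delta>_def using pos by (subst Min_gr_iff) auto
  \<comment> \<open>Doeblin's estimate is taken at a maximiser of \<open>F (N + n)\<close> and a
    minimiser of \<open>F n\<close>. In the limit it reads
    \<open>\<delta> * (B - A) \<le> 0\<close>.\<close>
  have "b (N + n) \<le> b n - \<delta> * (b n - a n)" for n
    unfolding x1[of "N + n"] F_add x0[of n]
    by (rule doeblin_upper_bound[OF markov_kernel_power[OF K] \<delta> Fb])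
  moreover have "(\<lambda>n. b (N + n)) \<longlonglongrightarrow> B"
    using LIMSEQ_ignore_initial_segment[OF B, of N] by (simp add: add.commute)
  moreover have "(\<lambda>n. b n - \<delta> * (b n - a n)) \<longlonglongrightarrow> B - \<delta> * (B - A)"
    by (intro tendsto_intros A B)
  ultimately have "B \<le> B - \<delta> * (B - A)" by (meson LIMSEQ_le)
  then have "\<delta> * (B - A) \<le> 0" by simp
  then have "B \<le> A" using \<delta>_pos by (simp add: mult_le_0_iff)
  moreover have "A \<le> B" using A B ab by (meson LIMSEQ_le)
  ultimately have AB: "A = B" by simp
  show thesis
  proof (rule that)
    show "(\<lambda>n. (kernel_power K n *v f) $ x) \<longlonglongrightarrow> A" for x
      using tendsto_sandwich[of a "\<lambda>n. F n $ x" _ b] aF Fb A B AB by (simp add: F_def)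
    show "m \<le> A" if "\<And>x. m \<le> (kernel_power K n *v f) $ x" for n m
      using le_a[of m n 0] that incseq_le[OF inc A, of n] by (simp add: F_def)
  qed
qed

text \<open>Column \<open>z\<close> of a power is that power applied to \<open>axis z 1\<close>. The
  minimum of the column of the positive power bounds the limit away from 0.\<close>

lemma kernel_power_tendsto_pos:
  fixes K :: "real^'v^'v"
  assumes K: "markov_kernel K" and pos: "\<And>x y. kernel_power K N $ x $ y > 0"
  obtains q :: "real^'v" where "\<And>z. q $ z > 0"
    and "\<And>x z. (\<lambda>n. kernel_power K n $ x $ z) \<longlonglongrightarrow> q $ z"
proof -
  have "\<exists>c>0. \<forall>x. (\<lambda>n. kernel_power K n $ x $ z) \<longlonglongrightarrow> c" for z
  proof -
    have col: "(A *v axis z 1) $ x = A $ x $ z" for A :: "real^'v^'v" and x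
      by (simp add: matrix_vector_mult_basis column_def)
    obtain c where c: "\<And>x. (\<lambda>n. kernel_power K n $ x $ z) \<longlonglongrightarrow> c"
      and le: "\<And>n m. (\<And>x. m \<le> kernel_power K n $ x $ z) \<Longrightarrow> m \<le> c"
      using markov_kernel_power_converges[OF K pos, of "axis z 1"] unfolding col by metis
    let ?m = "Min (range (\<lambda>x. kernel_power K N $ x $ z))"
    have "?m > 0" using pos by (subst Min_gr_iff) auto
    moreover have "?m \<le> c" by (rule le[of _ N]) auto
    ultimately have "c > 0" by linarith
    with c show ?thesis by blast
  qed
  then obtain r where r: "\<And>z. r z > 0" "\<And>x z. (\<lambda>n. kernel_power K n $ x $ z) \<longlonglongrightarrow> r z" by metis
  show thesis by (rule that[of "\<chi> z. r z"]) (use r in simp_all)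
qed

lemma invariant_prob_kernel_power:
  assumes "invariant_prob K p"
  shows "p v* kernel_power K n = p"
proof (induction n)
  case (Suc n)
  then show ?case using assms
    by (simp add: kernel_power_Suc invariant_prob_def flip: vector_matrix_mul_assoc)
qed simp

lemma invariant_prob_limit:
  fixes K :: "real^'v^'v" and q :: "real^'v"
  assumes K: "markov_kernel K"
    and lim: "\<And>x z. (\<lambda>n. kernel_power K n $ x $ z) \<longlonglongrightarrow> q $ z"
  shows "invariant_prob K q" and "\<And>p. invariant_prob K p \<Longrightarrow> p = q"
proof -
  fix x0 :: 'v
  have "0 \<le> q $ z" for z
    using lim[of x0 z] markov_kernel_nonneg[OF markov_kernel_power[OF K]]
    by (auto intro: LIMSEQ_le_const)
  moreover have "(\<Sum>z\<in>UNIV. q $ z) = 1"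
  proof (rule LIMSEQ_unique)
    show "(\<lambda>n. \<Sum>z\<in>UNIV. kernel_power K n $ x0 $ z) \<longlonglongrightarrow> (\<Sum>z\<in>UNIV. q $ z)"
      by (intro tendsto_sum lim)
  qed (simp add: markov_kernel_sum markov_kernel_power K)
  moreover have "q v* K = q"
  \<comment> \<open>The powers of exponent \<open>Suc n\<close> have the limit \<open>q\<close> as a
    shifted sequence and the limit \<open>q v* K\<close> through their last factor.\<close>
  proof (rule vec_eq_iff[THEN iffD2], rule allI, rule LIMSEQ_unique)
    fix z
    show "(\<lambda>n. kernel_power K (Suc n) $ x0 $ z) \<longlonglongrightarrow> q $ z"
      using lim by (rule LIMSEQ_Suc)
    show "(\<lambda>n. kernel_power K (Suc n) $ x0 $ z) \<longlonglongrightarrow> (q v* K) $ z"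
      unfolding kernel_power_Suc matrix_mult_component vector_matrix_mult_def
      by (simp add: mult.commute[of "K $ _ $ _"]) (intro tendsto_intros lim)
  qed
  ultimately show "invariant_prob K q" by (simp add: invariant_prob_def)
next
  fix p assume p: "invariant_prob K p"
  show "p = q"
  proof (rule vec_eq_iff[THEN iffD2], rule allI, rule LIMSEQ_unique)
    fix z
    \<comment> \<open>Invariance makes this sequence constantly \<open>p $ z\<close>, while the
      common limit of the rows sends it to \<open>q $ z\<close>.\<close>
    have "(\<lambda>n. \<Sum>x\<in>UNIV. p $ x * kernel_power K n $ x $ z) \<longlonglongrightarrow> (\<Sum>x\<in>UNIV. p $ x * q $ z)"
      by (intro tendsto_intros lim)
    also have "(\<lambda>n. \<Sum>x\<in>UNIV. p $ x * kernel_power K n $ x $ z) = (\<lambda>n. (p v* kernel_power K n) $ z)"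
      by (simp add: vector_matrix_mult_def mult.commute)
    also have "\<dots> = (\<lambda>_. p $ z)" by (simp add: invariant_prob_kernel_power p)
    also have "(\<Sum>x\<in>UNIV. p $ x * q $ z) = q $ z"
      using p by (simp add: invariant_prob_def flip: sum_distrib_right)
    finally show "(\<lambda>_. p $ z) \<longlonglongrightarrow> q $ z" .
  qed simp
qed

section \<open>Relative-sup merging for powers of one kernel\<close>

text \<open>The distance compares entries within one column only, so relabelling columns merely
  reindexes the maximum and the test for zeros.\<close>

lemma rel_sup_dist_permute_columns:
  fixes P Q :: "real^'v^'v"
  assumes h: "bij h" and Q: "\<And>x z. Q $ x $ z = P $ x $ h z"
  shows "rel_sup_dist Q = rel_sup_dist P"
proof -
  let ?F = "\<lambda>R :: real^'v^'v. (\<lambda>(x, y, z). \<bar>R $ x $ z / R $ y $ z - 1\<bar>)"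
  have sur: "\<exists>z'. z = h z'" for z using h by (metis bij_pointE)
  have "range (\<lambda>(x, y, z). (x, y, h z)) = (UNIV :: ('v \<times> 'v \<times> 'v) set)"
    using sur by (fastforce simp: image_iff)
  then have "range (?F P) = ?F P ` range (\<lambda>(x, y, z). (x, y, h z))" by simp
  also have "\<dots> = range (?F Q)" by (simp add: image_image Q case_prod_unfold)
  finally have "range (?F P) = range (?F Q)" .
  moreover have "(\<exists>y z. Q $ y $ z = 0) \<longleftrightarrow> (\<exists>y z. P $ y $ z = 0)"
    unfolding Q by (metis sur)
  ultimately show ?thesis unfolding rel_sup_dist_def by simp
qed

lemma merging_rel_sup_iff:
  fixes K :: "real^'v^'v"
  assumes K: "markov_kernel K"
  shows "merging_rel_sup (\<lambda>_. K) \<longleftrightarrow> irreducible_kernel K \<and> aperiodic_kernel K"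
proof
  assume "merging_rel_sup (\<lambda>_. K)"
  \<comment> \<open>Convergence to 0 makes the distance eventually finite, which excludes zero
    entries.\<close>
  then have "\<forall>\<^sub>F n in sequentially. rel_sup_dist (kernel_power K n) < \<infinity>"
    unfolding merging_rel_sup_def kernel_power_def
    by (rule order_tendstoD) simp
  then obtain N where N: "\<And>n. n \<ge> N \<Longrightarrow> rel_sup_dist (kernel_power K n) < \<infinity>"
    by (auto simp: eventually_sequentially)
  have "kernel_power K n $ x $ y > 0" if "n \<ge> N" for n x y
  proof -
    have "kernel_power K n $ x $ y \<noteq> 0"
      using N[OF that] unfolding rel_sup_dist_def by (auto split: if_splits)
    then show ?thesis
      using markov_kernel_nonneg[OF markov_kernel_power[OF K], of n x y] by simp
  qed
  then show "irreducible_kernel K \<and> aperiodic_kernel K"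
    using eventually_pos_imp_irreducible_aperiodic by metis
next
  assume "irreducible_kernel K \<and> aperiodic_kernel K"
  then obtain N where N: "\<And>n x y. n \<ge> N \<Longrightarrow> kernel_power K n $ x $ y > 0"
    using irreducible_aperiodic_imp_eventually_pos K by metis
  obtain q where q: "\<And>z. q $ z > 0" and lim: "\<And>x z. (\<lambda>n. kernel_power K n $ x $ z) \<longlonglongrightarrow> q $ z"
    using kernel_power_tendsto_pos[OF K N] by blast
  define D where "D n = (\<lambda>(x, y, z). \<bar>kernel_power K n $ x $ z / kernel_power K n $ y $ z - 1\<bar>)" for n
  have "(\<lambda>n. D n i) \<longlonglongrightarrow> 0" for i
  proof (cases i)
    case (fields x y z)
    have "(\<lambda>n. \<bar>kernel_power K n $ x $ z / kernel_power K n $ y $ z - 1\<bar>)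
        \<longlonglongrightarrow> \<bar>q $ z / q $ z - 1\<bar>"
      using q[of z] by (intro tendsto_intros lim) simp
    then show ?thesis using q[of z] by (simp add: D_def fields)
  qed
  then have upper: "(\<lambda>n. \<Sum>i\<in>UNIV. D n i) \<longlonglongrightarrow> 0" by (rule tendsto_null_sum)
  have bounds: "0 \<le> Max (range (D n)) \<and> Max (range (D n)) \<le> (\<Sum>i\<in>UNIV. D n i)" for n
  proof -
    have nn: "D n i \<ge> 0" for i by (simp add: D_def case_prod_unfold)
    have "Max (range (D n)) \<in> range (D n)" by (rule Max_in) auto
    then obtain i where "Max (range (D n)) = D n i" by blast
    moreover have "D n i \<le> (\<Sum>i\<in>UNIV. D n i)" by (rule member_le_sum) (auto simp: nn)
    ultimately show ?thesis using nn[of i] by simp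
  qed
  \<comment> \<open>The maximum is squeezed between 0 and the finite sum of terms that each tend to
    0.\<close>
  have "(\<lambda>n. Max (range (D n))) \<longlonglongrightarrow> 0"
    by (rule tendsto_sandwich[OF _ _ tendsto_const upper]) (simp_all only: bounds eventually_True)
  then have "(\<lambda>n. ereal (Max (range (D n)))) \<longlonglongrightarrow> 0" by (simp add: zero_ereal_def)
  \<comment> \<open>Only from \<open>N\<close> on is the infinite branch of the distance ruled out,
    hence the eventual equality.\<close>
  moreover have "\<forall>\<^sub>F n in sequentially. ereal (Max (range (D n))) = rel_sup_dist (kernel_power K n)"
    using eventually_ge_at_top[of N]
  proof eventually_elim
    case (elim n)
    then have "\<not> (\<exists>y z. kernel_power K n $ y $ z = 0)" using N by (metis less_irrefl)
    then show ?case by (simp add: rel_sup_dist_def D_def)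
  qed
  ultimately show "merging_rel_sup (\<lambda>_. K)"
    unfolding merging_rel_sup_def kernel_power_def by (rule Lim_transform_eventually)
qed

subsection \<open>Self-adjoint operators and singular values\<close>

lemma l2_inner_commute: "l2_inner p f h = l2_inner p h f"
  by (simp add: l2_inner_def mult.commute)

lemma l2_inner_add_left: "l2_inner p (f + f') h = l2_inner p f h + l2_inner p f' h"
  and l2_inner_add_right: "l2_inner p f (h + h') = l2_inner p f h + l2_inner p f h'"
  and l2_inner_diff_left: "l2_inner p (f - f') h = l2_inner p f h - l2_inner p f' h"
  and l2_inner_diff_right: "l2_inner p f (h - h') = l2_inner p f h - l2_inner p f h'"
  and l2_inner_scaleR_left: "l2_inner p (c *\<^sub>R f) h = c * l2_inner p f h"
  and l2_inner_scaleR_right: "l2_inner p f (c *\<^sub>R h) = c * l2_inner p f h"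
  by (simp_all add: l2_inner_def sum.distrib sum_subtractf sum_distrib_left algebra_simps)

lemmas l2_inner_simps = l2_inner_add_left l2_inner_add_right l2_inner_diff_left
  l2_inner_diff_right l2_inner_scaleR_left l2_inner_scaleR_right

lemma l2_inner_self_nonneg:
  assumes "\<And>x. 0 \<le> p $ x"
  shows "0 \<le> l2_inner p f f"
  unfolding l2_inner_def by (intro sum_nonneg) (simp add: assms)

lemma l2_inner_self_eq_0_iff:
  assumes "\<And>x. 0 < p $ x"
  shows "l2_inner p f f = 0 \<longleftrightarrow> f = 0"
proof -
  have "l2_inner p f f = 0 \<longleftrightarrow> (\<forall>x. f $ x * f $ x * p $ x = 0)"
    unfolding l2_inner_def
    by (subst sum_nonneg_eq_0_iff) (simp_all add: assms less_imp_le)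
  also have "\<dots> \<longleftrightarrow> f = 0"
    using assms by (auto simp: vec_eq_iff less_le)
  finally show ?thesis .
qed

text \<open>Multiplication by the square root of \<open>p\<close> embeds the weighted space in
  Euclidean space. Cauchy-Schwarz and independence of orthogonal vectors are transferred along
  it.\<close>

lemma l2_inner_eq_inner:
  assumes "\<And>x. 0 \<le> p $ x"
  shows "l2_inner p f h = (\<chi> x. sqrt (p $ x) * f $ x) \<bullet> (\<chi> x. sqrt (p $ x) * h $ x)"
  unfolding l2_inner_def inner_vec_def
proof (rule sum.cong[OF refl])
  fix x
  have "sqrt (p $ x) * sqrt (p $ x) = p $ x" using assms by simp
  then show "f $ x * h $ x * p $ x
      = (\<chi> x. sqrt (p $ x) * f $ x) $ x \<bullet> (\<chi> x. sqrt (p $ x) * h $ x) $ x"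
    by (simp add: algebra_simps)
qed

lemma l2_inner_Cauchy_Schwarz:
  assumes "\<And>x. 0 \<le> p $ x"
  shows "\<bar>l2_inner p f h\<bar> \<le> sqrt (l2_inner p f f) * sqrt (l2_inner p h h)"
  unfolding l2_inner_eq_inner[OF assms]
  using Cauchy_Schwarz_ineq2 by (simp add: norm_eq_sqrt_inner)

text \<open>When \<open>p\<close> is a positive invariant measure of a Markov kernel, this is the
  time-reversed kernel.\<close>

definition l2_adjoint_matrix :: "real^'v \<Rightarrow> real^'v^'v \<Rightarrow> real^'v^'v" where
  "l2_adjoint_matrix p A = (\<chi> y x. p $ x * A $ x $ y / p $ y)"

lemma l2_inner_adjoint_matrix:
  fixes p :: "real^'v"
  assumes "\<And>x. 0 < p $ x"
  shows "l2_inner p (A *v f) h = l2_inner p f (l2_adjoint_matrix p A *v h)"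
proof -
  have "p $ y \<noteq> 0" for y using assms[of y] by simp
  then have "l2_inner p f (l2_adjoint_matrix p A *v h)
      = (\<Sum>y\<in>UNIV. \<Sum>x\<in>UNIV. A $ x $ y * f $ y * h $ x * p $ x)"
    unfolding l2_inner_def l2_adjoint_matrix_def matrix_vector_mult_def
    by (intro sum.cong refl) (simp add: sum_distrib_left sum_distrib_right, intro sum.cong refl, simp)
  also have "\<dots> = l2_inner p (A *v f) h"
    unfolding l2_inner_def matrix_vector_mult_def
    by (subst sum.swap) (simp add: sum_distrib_right)
  finally show ?thesis ..
qed

text \<open>Resolves the definite description: two candidates differ at \<open>h\<close> by a vector
  orthogonal to every \<open>f\<close>, in particular to itself.\<close>

lemma l2_adjoint_eq:
  fixes p :: "real^'v"
  assumes p: "\<And>x. 0 < p $ x"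
  shows "l2_adjoint p ((*v) A) = (*v) (l2_adjoint_matrix p A)"
  unfolding l2_adjoint_def
proof (rule the_equality)
  show "\<forall>f h. l2_inner p (A *v f) h = l2_inner p f (l2_adjoint_matrix p A *v h)"
    using l2_inner_adjoint_matrix[OF p] by blast
next
  fix S assume S: "\<forall>f h. l2_inner p (A *v f) h = l2_inner p f (S h)"
  show "S = (*v) (l2_adjoint_matrix p A)"
  proof
    fix h
    let ?d = "S h - l2_adjoint_matrix p A *v h"
    have "l2_inner p ?d ?d = 0"
      using S l2_inner_adjoint_matrix[OF p, of A ?d h] by (simp add: l2_inner_diff_right)
    then show "S h = l2_adjoint_matrix p A *v h" by (simp add: l2_inner_self_eq_0_iff[OF p])
  qed
qed

section \<open>Eigenvalues of self-adjoint operators with multiplicity\<close>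

text \<open>Eigenvectors for distinct eigenvalues are orthogonal, hence independent in finite
  dimension. Finiteness matters because the sum defining \<open>eigenvalue_mset\<close> would
  collapse to the empty multiset over an infinite set.\<close>

lemma finite_eigenvalues_self_adjoint:
  fixes T :: "real^'v \<Rightarrow> real^'v"
  assumes p: "\<And>x. 0 < p $ x" and T: "\<And>f h. l2_inner p (T f) h = l2_inner p f (T h)"
  shows "finite (eigenvalues T)"
proof -
  have "\<forall>c\<in>eigenvalues T. \<exists>f. f \<noteq> 0 \<and> T f = c *\<^sub>R f" by (simp add: eigenvalues_def)
  then obtain v where v: "\<And>c. c \<in> eigenvalues T \<Longrightarrow> v c \<noteq> 0"
    "\<And>c. c \<in> eigenvalues T \<Longrightarrow> T (v c) = c *\<^sub>R v c" by metis
  define w :: "real \<Rightarrow> real^'v" where "w c = (\<chi> x. sqrt (p $ x) * v c $ x)" for c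
  have w: "w c \<bullet> w d = l2_inner p (v c) (v d)" for c d
    using l2_inner_eq_inner[of p "v c" "v d"] p by (simp add: w_def less_imp_le)
  have orth: "w c \<bullet> w d = 0" if "c \<in> eigenvalues T" "d \<in> eigenvalues T" "c \<noteq> d" for c d
    using T[of "v c" "v d"] v that by (simp add: w l2_inner_simps)
  have nz: "w c \<bullet> w c \<noteq> 0" if "c \<in> eigenvalues T" for c
    using v(1)[OF that] by (simp add: w l2_inner_self_eq_0_iff[OF p])
  have "inj_on w (eigenvalues T)"
    by (rule inj_onI) (metis orth nz)
  moreover have "independent (w ` eigenvalues T)"
    by (rule pairwise_orthogonal_independent) (use orth nz in \<open>force simp: pairwise_def orthogonal_def\<close>)+
  then have "finite (w ` eigenvalues T)" by (rule independent_imp_finite)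
  ultimately show ?thesis by (rule finite_imageD[rotated])
qed

lemma count_eigenvalue_mset:
  assumes "finite (eigenvalues T)" "c \<in> eigenvalues T"
  shows "count (eigenvalue_mset T) c = dim (eigenspace T c)"
  using assms by (simp add: eigenvalue_mset_def count_sum if_distrib sum.delta cong: if_cong)

text \<open>The delicate case is \<open>c = d\<close>: orthogonality makes \<open>f\<close> and
  \<open>h\<close> independent, so the eigenspace has dimension at least 2 and the value is listed
  twice.\<close>

lemma orthogonal_eigenvectors_mset:
  fixes T :: "real^'v \<Rightarrow> real^'v"
  assumes p: "\<And>x. 0 < p $ x" and T: "\<And>f h. l2_inner p (T f) h = l2_inner p f (T h)"
    and f: "f \<noteq> 0" "T f = c *\<^sub>R f" and h: "h \<noteq> 0" "T h = d *\<^sub>R h"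
    and fh: "l2_inner p f h = 0"
  shows "{#c, d#} \<subseteq># eigenvalue_mset T"
proof -
  note fin = finite_eigenvalues_self_adjoint[OF p T]
  have ev: "c \<in> eigenvalues T" "d \<in> eigenvalues T" using f h by (auto simp: eigenvalues_def)
  have "dim (eigenspace T c) \<ge> 1" "dim (eigenspace T d) \<ge> 1"
    using f h by (auto simp: eigenspace_def Suc_le_eq simp flip: neq0_conv)
  moreover have "dim (eigenspace T c) \<ge> 2" if "c = d"
  proof -
    have "f \<noteq> h" using fh f by (auto simp: l2_inner_self_eq_0_iff[OF p])
    have "f \<notin> span {h}"
    proof
      assume "f \<in> span {h}"
      then obtain k where "f = k *\<^sub>R h" unfolding span_singleton by blast
      then have "l2_inner p f f = k * l2_inner p f h" by (metis l2_inner_scaleR_right)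
      with fh have "l2_inner p f f = 0" by (simp only: mult_zero_right)
      then show False using f by (simp add: l2_inner_self_eq_0_iff[OF p])
    qed
    then have "independent {f, h}" using h by (auto simp: independent_insert)
    moreover have "{f, h} \<subseteq> eigenspace T c" using f h that by (auto simp: eigenspace_def)
    ultimately have "card {f, h} \<le> dim (eigenspace T c)" by (intro independent_card_le_dim)
    then show ?thesis using \<open>f \<noteq> h\<close> by simp
  qed
  ultimately show ?thesis
    by (intro mset_subset_eqI) (auto simp: count_eigenvalue_mset[OF fin] ev simp del: count_greater_eq_Suc_zero_iff)
qed

text \<open>Each coordinate satisfies \<open>p $ x * (f $ x)\<^sup>2 \<le> 1\<close>, and
  \<open>p $ x\<close> is positive. This supplies the compactness for maximising the Rayleigh
  quotient.\<close>

lemma bounded_l2_unit_sphere: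
  assumes p: "\<And>x. 0 < p $ x"
  shows "bounded {f. l2_inner p f f = 1}"
proof -
  have "norm f \<le> (\<Sum>x\<in>UNIV. sqrt (1 / p $ x))" if f: "l2_inner p f f = 1" for f
  proof -
    have "\<bar>f $ x\<bar> \<le> sqrt (1 / p $ x)" for x
    proof -
      have "f $ x * f $ x * p $ x \<le> l2_inner p f f"
        unfolding l2_inner_def
        by (rule member_le_sum) (simp_all add: less_imp_le p)
      then have "(f $ x)\<^sup>2 \<le> 1 / p $ x" using f p[of x] by (simp add: field_simps power2_eq_square)
      then show ?thesis by (metis real_sqrt_abs real_sqrt_le_mono)
    qed
    then have "(\<Sum>x\<in>UNIV. \<bar>f $ x\<bar>) \<le> (\<Sum>x\<in>UNIV. sqrt (1 / p $ x))" by (rule sum_mono)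
    then show ?thesis using norm_le_l1_cart[of f] by simp
  qed
  then show ?thesis by (auto simp: bounded_iff)
qed

lemma continuous_on_l2_inner:
  assumes "continuous_on U F" "continuous_on U G"
  shows "continuous_on U (\<lambda>f. l2_inner p (F f) (G f))"
  unfolding l2_inner_def by (intro continuous_intros assms)

text \<open>
  The Rayleigh quotient attains its maximum on the unit sphere of \<open>W\<close>. At a maximiser \<open>f\<close> the
  nonnegative quadratic form \<open>c \<langle>h, h\<rangle> - \<langle>A h, h\<rangle>\<close> vanishes, hence so does its polarisation
  against every element of \<open>W\<close>, in particular against the residual \<open>c f - A f\<close>.
\<close>

lemma self_adjoint_maximal_eigenvector:
  fixes A :: "real^'v^'v"
  assumes p: "\<And>x. 0 < p $ x"
    and A: "\<And>f h. l2_inner p (A *v f) h = l2_inner p f (A *v h)"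
    and W: "subspace W" and inv: "\<And>f. f \<in> W \<Longrightarrow> A *v f \<in> W"
    and u: "u \<in> W" "u \<noteq> 0"
  obtains f c where "f \<in> W" "f \<noteq> 0" "A *v f = c *\<^sub>R f"
    and "\<And>h. h \<in> W \<Longrightarrow> l2_inner p (A *v h) h \<le> c * l2_inner p h h"
proof -
  let ?U = "W \<inter> {f. l2_inner p f f = 1}"
  have pos: "l2_inner p h h > 0" if "h \<noteq> 0" for h
    using that l2_inner_self_nonneg[of p h] l2_inner_self_eq_0_iff[OF p, of h] p
    by (simp add: less_le)
  have normalise: "(1 / sqrt (l2_inner p h h)) *\<^sub>R h \<in> ?U" if "h \<in> W" "h \<noteq> 0" for h
    using that pos[of h] W by (simp add: subspace_scale l2_inner_simps)
  have "closed ?U"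
    by (intro closed_Int closed_subspace W closed_Collect_eq continuous_on_l2_inner continuous_intros)
  then have "compact ?U"
    using bounded_l2_unit_sphere[OF p] by (simp add: compact_eq_bounded_closed bounded_Int)
  moreover have "?U \<noteq> {}" using normalise u by blast
  moreover have "continuous_on ?U (\<lambda>h. l2_inner p (A *v h) h)"
    by (intro continuous_on_l2_inner continuous_intros matrix_vector_mult_linear_continuous_on)
  ultimately obtain f where f: "f \<in> ?U"
    and max: "\<And>h. h \<in> ?U \<Longrightarrow> l2_inner p (A *v h) h \<le> l2_inner p (A *v f) f"
    using continuous_attains_sup[of ?U "\<lambda>h. l2_inner p (A *v h) h"] by blast
  define c where "c = l2_inner p (A *v f) f"
  have bound: "l2_inner p (A *v h) h \<le> c * l2_inner p h h" if "h \<in> W" for h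
  proof (cases "h = 0")
    case False
    have "l2_inner p (A *v h) h / l2_inner p h h \<le> c"
      using max[OF normalise[OF that False]] pos[OF False]
      by (simp add: c_def l2_inner_simps matrix_vector_mult_scaleR)
    then show ?thesis using pos[OF False] by (simp add: pos_divide_le_eq)
  qed (simp add: l2_inner_def)
  define r where "r = c *\<^sub>R f - A *v f"
  have r: "r \<in> W" using f W inv by (simp add: r_def subspace_diff subspace_scale)
  define a where "a = l2_inner p r r"
  define b where "b = c * a - l2_inner p (A *v r) r"
  \<comment> \<open>Expand the form at \<open>f + t *\<^sub>R r\<close>: its constant term vanishes
    at the maximiser, and its linear coefficient is twice the squared norm of the residual.\<close>
  have quad: "0 \<le> 2 * t * a + t\<^sup>2 * b" for t
  proof -
    have "f + t *\<^sub>R r \<in> W" using f r W by (simp add: subspace_add subspace_scale)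
    from bound[OF this] have "0 \<le> c * l2_inner p (f + t *\<^sub>R r) (f + t *\<^sub>R r)
        - l2_inner p (A *v (f + t *\<^sub>R r)) (f + t *\<^sub>R r)" by simp
    also have "\<dots> = c * l2_inner p f f - l2_inner p (A *v f) f
        + 2 * t * (c * l2_inner p f r - l2_inner p (A *v f) r) + t\<^sup>2 * b"
      using A[of r f] l2_inner_commute[of p r f] l2_inner_commute[of p r "A *v f"]
      by (simp add: b_def a_def l2_inner_simps matrix_vector_right_distrib matrix_vector_mult_scaleR
          algebra_simps power2_eq_square)
    also have "c * l2_inner p f f - l2_inner p (A *v f) f = 0" using f by (simp add: c_def)
    also have "c * l2_inner p f r - l2_inner p (A *v f) r = a"
      by (simp add: a_def r_def l2_inner_diff_left l2_inner_scaleR_left)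
    finally show ?thesis by simp
  qed
  have "a \<ge> 0" unfolding a_def using p by (intro l2_inner_self_nonneg less_imp_le)
  have "a = 0"
  proof (rule ccontr)
    assume "a \<noteq> 0"
    with \<open>a \<ge> 0\<close> have "a > 0" by simp
    \<comment> \<open>This \<open>t\<close> is negative with
      \<open>\<bar>t\<bar> * \<bar>b\<bar> \<le> a\<close>, so the linear term dominates and the
      quadratic is negative.\<close>
    define t where "t = - a / (\<bar>b\<bar> + 1)"
    have "t < 0" using \<open>a > 0\<close> by (simp add: t_def divide_neg_pos)
    have "\<bar>t\<bar> * \<bar>b\<bar> \<le> a" using \<open>a > 0\<close> by (simp add: t_def abs_divide field_simps)
    moreover have "t * b \<ge> - (\<bar>t\<bar> * \<bar>b\<bar>)" using abs_ge_minus_self[of "t * b"] by (simp add: abs_mult)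
    ultimately have "2 * a + t * b > 0" using \<open>a > 0\<close> by linarith
    then have "t * (2 * a + t * b) < 0" using \<open>t < 0\<close> by (simp add: mult_neg_pos)
    then show False using quad[of t] by (simp add: algebra_simps power2_eq_square)
  qed
  then have "A *v f = c *\<^sub>R f" by (simp add: a_def r_def l2_inner_self_eq_0_iff[OF p])
  moreover have "f \<noteq> 0" using f by (auto simp: l2_inner_def)
  ultimately show thesis using that f bound by blast
qed

text \<open>At most one of the two listed occurrences can be the head, so the other lies at index 1
  or later.\<close>

lemma nth_1_ge_of_sorted_desc:
  fixes xs :: "'a::linorder list"
  assumes sorted: "sorted (rev xs)" and sub: "{#a, b#} \<subseteq># mset xs" and c: "c \<le> a" "c \<le> b"
  shows "c \<le> xs ! 1"
proof -
  have "2 \<le> length xs" using size_mset_mono[OF sub] by simp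
  then obtain x y ys where xs: "xs = x # y # ys"
    by (metis One_nat_def Suc_le_length_iff numeral_2_eq_2)
  have "a \<in># mset (y # ys) \<or> b \<in># mset (y # ys)"
  proof (cases "a = x")
    case True
    then show ?thesis using sub by (simp add: xs insert_subset_eq_iff)
  next
    case False
    then show ?thesis using mset_subset_eqD[OF sub, of a] by (simp add: xs)
  qed
  moreover have "w \<le> y" if "w \<in># mset (y # ys)" for w
    using sorted that by (auto simp: xs sorted_append)
  ultimately show ?thesis using c by (auto simp: xs intro: order_trans)
qed

subsection \<open>The bound for Markov kernels\<close>

lemma markov_kernel_mult_one: "markov_kernel K \<Longrightarrow> K *v 1 = 1"
  by (simp add: vec_eq_iff matrix_vector_mult_def markov_kernel_sum)

lemma invariant_prob_sum: "invariant_prob K p \<Longrightarrow> (\<Sum>x\<in>UNIV. K $ x $ y * p $ x) = p $ y"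
  by (auto simp: invariant_prob_def vec_eq_iff vector_matrix_mult_def mult.commute)

text \<open>Invariance means that \<open>K\<close> preserves the mean under \<open>p\<close>; hence
  it maps the orthogonal complement of the constants into itself.\<close>

lemma l2_inner_one_mult:
  assumes "invariant_prob K p"
  shows "l2_inner p (K *v f) 1 = l2_inner p f 1"
proof -
  have "l2_inner p (K *v f) 1 = (\<Sum>x\<in>UNIV. \<Sum>y\<in>UNIV. f $ y * (K $ x $ y * p $ x))"
    by (simp add: l2_inner_def matrix_vector_mult_def sum_distrib_left mult_ac)
  also have "\<dots> = (\<Sum>y\<in>UNIV. f $ y * (\<Sum>x\<in>UNIV. K $ x $ y * p $ x))"
    by (subst sum.swap) (simp add: sum_distrib_left)
  also have "\<dots> = l2_inner p f 1" by (simp add: invariant_prob_sum[OF assms] l2_inner_def)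
  finally show ?thesis .
qed

text \<open>Jensen's inequality, from the nonnegative variance of \<open>f\<close> under row
  \<open>x\<close> of \<open>K\<close>.\<close>

lemma markov_kernel_square_le:
  assumes K: "markov_kernel K"
  shows "((K *v f) $ x)\<^sup>2 \<le> (K *v (\<chi> y. (f $ y)\<^sup>2)) $ x"
proof -
  let ?c = "(K *v f) $ x"
  have "0 \<le> (\<Sum>y\<in>UNIV. K $ x $ y * (f $ y - ?c)\<^sup>2)"
    by (intro sum_nonneg mult_nonneg_nonneg markov_kernel_nonneg K) simp
  also have "\<dots> = (\<Sum>y\<in>UNIV. K $ x $ y * (f $ y)\<^sup>2 - 2 * ?c * (K $ x $ y * f $ y) + ?c\<^sup>2 * K $ x $ y)"
    by (intro sum.cong refl) (simp add: power2_eq_square algebra_simps)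
  also have "\<dots> = (K *v (\<chi> y. (f $ y)\<^sup>2)) $ x - 2 * ?c * ?c + ?c\<^sup>2"
    by (simp only: sum.distrib sum_subtractf flip: sum_distrib_left)
      (simp add: markov_kernel_sum K matrix_vector_mult_def)
  finally show ?thesis by (simp add: power2_eq_square)
qed

lemma l2_contraction:
  assumes K: "markov_kernel K" and p: "invariant_prob K p"
  shows "l2_inner p (K *v f) (K *v f) \<le> l2_inner p f f"
proof -
  have "l2_inner p (K *v f) (K *v f) \<le> l2_inner p (K *v (\<chi> y. (f $ y)\<^sup>2)) 1"
    unfolding l2_inner_def
    using p markov_kernel_square_le[OF K]
    by (intro sum_mono mult_right_mono) (simp_all add: power2_eq_square invariant_prob_def)
  also have "\<dots> = l2_inner p f f"
    unfolding l2_inner_one_mult[OF p] by (simp add: l2_inner_def power2_eq_square)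
  finally show ?thesis .
qed

text \<open>The vector \<open>u\<close> guarantees that there are at least two states, so that index
  1 exists. The largest eigenvalue \<open>c\<close> on the complement of the constants is listed
  besides the eigenvalue 1 of the constants, hence \<open>sqrt c\<close> is at most the entry at
  index 1.\<close>

lemma l2_norm_le_second_singular_value:
  fixes K :: "real^'v^'v"
  assumes K: "markov_kernel K" and inv: "invariant_prob K p" and p: "\<And>x. 0 < p $ x"
    and u: "l2_inner p u 1 = 0" "u \<noteq> 0"
  shows "0 \<le> singular_values p K ! 1"
    and "\<And>h. l2_inner p h 1 = 0 \<Longrightarrow>
      l2_inner p (K *v h) (K *v h) \<le> (singular_values p K ! 1)\<^sup>2 * l2_inner p h h"
proof -
  let ?S = "l2_adjoint_matrix p K ** K"
  let ?W = "{f. l2_inner p f 1 = 0}"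
  let ?s = "singular_values p K ! 1"
  have S: "l2_inner p (?S *v f) h = l2_inner p (K *v f) (K *v h)" for f h
    using l2_inner_adjoint_matrix[OF p, of K h "K *v f"]
    by (simp add: l2_inner_commute flip: matrix_vector_mul_assoc)
  have self: "l2_inner p (?S *v f) h = l2_inner p f (?S *v h)" for f h
    using S[of h f] unfolding S l2_inner_commute[of p f] by (simp add: l2_inner_commute)
  have one: "?S *v 1 = 1"
  proof -
    \<comment> \<open>The rows of the reversed kernel sum to 1 exactly because \<open>p\<close> is
      invariant.\<close>
    have "(l2_adjoint_matrix p K *v 1) $ y = 1" for y
    proof -
      show ?thesis using p[of y] invariant_prob_sum[OF inv, of y]
        by (simp add: l2_adjoint_matrix_def matrix_vector_mult_def mult.commute flip: sum_divide_distrib)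
    qed
    then show ?thesis
      by (simp add: markov_kernel_mult_one K vec_eq_iff flip: matrix_vector_mul_assoc)
  qed
  have W: "subspace ?W"
    by (auto simp: subspace_def l2_inner_simps) (simp add: l2_inner_def)
  have "?S *v f \<in> ?W" if "f \<in> ?W" for f
    using self[of f 1] that by (simp add: one)
  then obtain f c where f: "f \<in> ?W" "f \<noteq> 0" "?S *v f = c *\<^sub>R f"
    and max: "\<And>h. h \<in> ?W \<Longrightarrow> l2_inner p (?S *v h) h \<le> c * l2_inner p h h"
    using self_adjoint_maximal_eigenvector[OF p self W, of u] u by blast
  have pos: "l2_inner p f f > 0"
    using f(2) l2_inner_self_nonneg[of p f] l2_inner_self_eq_0_iff[OF p, of f] p by (simp add: less_le)
  have c: "l2_inner p (K *v f) (K *v f) = c * l2_inner p f f"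
    using S[of f f] by (simp add: f(3) l2_inner_simps)
  have "0 \<le> l2_inner p (K *v f) (K *v f)" using p by (intro l2_inner_self_nonneg less_imp_le)
  then have "0 \<le> c" using pos by (simp add: c zero_le_mult_iff)
  have "c * l2_inner p f f \<le> 1 * l2_inner p f f"
    using l2_contraction[OF K inv, of f] by (simp add: c)
  \<comment> \<open>Both 1 and \<open>sqrt c\<close> are then at least \<open>sqrt c\<close>, as the
    comparison with index 1 requires; this also covers \<open>c = 1\<close>.\<close>
  then have "c \<le> 1" using pos by (simp only: mult_le_cancel_right_pos)
  have "{#1, c#} \<subseteq># eigenvalue_mset ((*v) ?S)"
    by (rule orthogonal_eigenvectors_mset[OF p self, of 1 _ f])
      (use f one in \<open>simp_all add: l2_inner_commute vec_eq_iff\<close>)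
  then have "image_mset sqrt {#1, c#} \<subseteq># image_mset sqrt (eigenvalue_mset ((*v) ?S))"
    by (rule image_mset_subseteq_mono)
  moreover have "(*v) ?S = l2_adjoint p ((*v) K) \<circ> (*v) K"
    by (simp add: fun_eq_iff l2_adjoint_eq[OF p] matrix_vector_mul_assoc)
  ultimately have "{#1, sqrt c#} \<subseteq># mset (singular_values p K)"
    by (simp add: singular_values_def)
  then have s: "sqrt c \<le> ?s"
    by (rule nth_1_ge_of_sorted_desc[rotated])
      (use \<open>c \<le> 1\<close> in \<open>simp_all add: singular_values_def\<close>)
  then show "0 \<le> ?s" using \<open>0 \<le> c\<close> by (meson order_trans real_sqrt_ge_zero)
  have "c \<le> ?s\<^sup>2" using s \<open>0 \<le> c\<close> by (meson real_sqrt_le_iff sqrt_le_D)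
  fix h assume h: "l2_inner p h 1 = 0"
  have "l2_inner p (K *v h) (K *v h) \<le> c * l2_inner p h h" using max[of h] h S[of h h] by simp
  also have "\<dots> \<le> ?s\<^sup>2 * l2_inner p h h"
    using \<open>c \<le> ?s\<^sup>2\<close> p by (intro mult_right_mono l2_inner_self_nonneg) (simp_all add: less_imp_le)
  finally show "l2_inner p (K *v h) (K *v h) \<le> ?s\<^sup>2 * l2_inner p h h" .
qed

text \<open>The one-step bound iterates since \<open>K *v h\<close> is again orthogonal to the
  constants; the induction therefore generalises \<open>h\<close>.\<close>

lemma l2_norm_kernel_power_le:
  fixes K :: "real^'v^'v"
  assumes inv: "invariant_prob K p"
    and step: "\<And>h. l2_inner p h 1 = 0 \<Longrightarrow>
      l2_inner p (K *v h) (K *v h) \<le> s\<^sup>2 * l2_inner p h h"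
    and h: "l2_inner p h 1 = 0"
  shows "l2_inner p (kernel_power K n *v h) (kernel_power K n *v h) \<le> (s ^ n)\<^sup>2 * l2_inner p h h"
  using h
proof (induction n arbitrary: h)
  case (Suc n)
  have "l2_inner p (kernel_power K (Suc n) *v h) (kernel_power K (Suc n) *v h)
      \<le> (s ^ n)\<^sup>2 * l2_inner p (K *v h) (K *v h)"
    using Suc.IH[of "K *v h"] Suc.prems
    by (simp add: kernel_power_Suc l2_inner_one_mult[OF inv] flip: matrix_vector_mul_assoc)
  also have "\<dots> \<le> (s ^ n)\<^sup>2 * (s\<^sup>2 * l2_inner p h h)"
    by (intro mult_left_mono step Suc.prems) simp
  also have "\<dots> = (s ^ Suc n)\<^sup>2 * l2_inner p h h" by (simp add: power2_eq_square mult_ac)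
  finally show ?case .
qed simp

text \<open>
  With \<open>h\<^sub>w = \<delta>\<^sub>w / p(w) - 1\<close>, which is orthogonal to the constants and has squared norm
  \<open>1 / p(w) - 1\<close>, the quantity inside the absolute value is \<open>\<langle>K\<^sup>n h\<^sub>w, h\<^sub>x\<rangle>\<close>.
\<close>

lemma kernel_power_ratio_bound:
  fixes K :: "real^'v^'v"
  assumes K: "markov_kernel K" and inv: "invariant_prob K p" and p: "\<And>x. 0 < p $ x"
  shows "\<bar>kernel_power K n $ x $ w / p $ w - 1\<bar>
    \<le> sqrt (1 / p $ x - 1) * sqrt (1 / p $ w - 1) * (singular_values p K ! 1) ^ n"
proof -
  let ?s = "singular_values p K ! 1"
  define h :: "'v \<Rightarrow> real^'v" where "h y = axis y (1 / p $ y) - 1" for y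
  \<comment> \<open>The scaled indicator represents evaluation at \<open>y\<close> in the weighted
    inner product.\<close>
  have inner_axis: "l2_inner p f (axis y (1 / p $ y)) = f $ y" for f y
  proof -
    have "l2_inner p f (axis y (1 / p $ y)) = (\<Sum>x\<in>UNIV. if x = y then f $ y else 0)"
      unfolding l2_inner_def by (intro sum.cong refl) (use p[of y] in \<open>auto simp: axis_def\<close>)
    then show ?thesis by simp
  qed
  have "l2_inner p 1 1 = 1" using inv by (simp add: l2_inner_def invariant_prob_def)
  then have orth: "l2_inner p (h y) 1 = 0" for y
    using inner_axis[of 1 y]
    by (simp add: h_def l2_inner_diff_left l2_inner_commute[of p "axis y (1 / p $ y)"])
  have inner_h: "l2_inner p f (h y) = f $ y" if "l2_inner p f 1 = 0" for f y
    using that by (simp add: h_def l2_inner_diff_right inner_axis)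
  have norm_h: "l2_inner p (h y) (h y) = 1 / p $ y - 1" for y
    unfolding inner_h[OF orth] by (simp add: h_def axis_def)
  define g where "g = kernel_power K n *v h w"
  have axis: "axis w (1 / p $ w) = (1 / p $ w) *\<^sub>R axis w 1" by (simp add: vec_eq_iff axis_def)
  have g: "g $ x = kernel_power K n $ x $ w / p $ w - 1"
    using markov_kernel_mult_one[OF markov_kernel_power[OF K]] matrix_vector_mult_basis[of "kernel_power K n" w]
      matrix_vector_mult_scaleR[of "kernel_power K n" "1 / p $ w" "axis w 1"] axis
    by (simp add: g_def h_def matrix_vector_mult_diff_distrib column_def)
  show ?thesis
  proof (cases "h w = 0")
    case True
    \<comment> \<open>Here \<open>V\<close> has one point, so index \<open>1\<close> is out of range and \<open>?s\<close> is unspecified.\<close>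
    then have "g $ x = 0" "1 / p $ w - 1 = 0" using norm_h[of w] by (simp_all add: g_def l2_inner_def)
    then show ?thesis using g by simp
  next
    case False
    note sv = l2_norm_le_second_singular_value[OF K inv p orth False]
    have "l2_inner p g g \<le> (?s ^ n)\<^sup>2 * (1 / p $ w - 1)"
      unfolding g_def norm_h[symmetric] by (rule l2_norm_kernel_power_le[OF inv sv(2) orth])
    then have "sqrt (l2_inner p g g) \<le> sqrt ((?s ^ n)\<^sup>2 * (1 / p $ w - 1))" by simp
    also have "\<dots> = ?s ^ n * sqrt (1 / p $ w - 1)"
      using sv(1) by (simp add: real_sqrt_mult)
    finally have gg: "sqrt (l2_inner p g g) \<le> ?s ^ n * sqrt (1 / p $ w - 1)" .
    \<comment> \<open>Hence \<open>g\<close> stays orthogonal to the constants, and pairing it with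
      \<open>h x\<close> evaluates it at \<open>x\<close>.\<close>
    have "invariant_prob (kernel_power K n) p"
      using inv invariant_prob_kernel_power[OF inv] by (simp add: invariant_prob_def)
    then have "l2_inner p g (h x) = g $ x"
      by (intro inner_h) (simp add: g_def l2_inner_one_mult orth)
    then have "\<bar>g $ x\<bar> \<le> sqrt (l2_inner p g g) * sqrt (1 / p $ x - 1)"
      using l2_inner_Cauchy_Schwarz[of p g "h x"] p by (simp add: less_imp_le norm_h)
    also have "\<dots> \<le> ?s ^ n * sqrt (1 / p $ w - 1) * sqrt (1 / p $ x - 1)"
      by (rule mult_right_mono[OF gg]) (metis norm_h l2_inner_self_nonneg p less_imp_le real_sqrt_ge_zero)
    finally show ?thesis by (simp add: g mult_ac)
  qed
qed

section \<open>Telescoping and the main result\<close>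

lemma kernel_prod_shifted:
  fixes K Kt :: "real^'v^'v"
  assumes g: "bij g"
    and Ks: "\<And>i. i \<ge> 1 \<Longrightarrow> Ks i = (\<chi> x y. K $ ((g ^^ (i - 1)) x) $ ((g ^^ (i - 1)) y))"
    and Kt: "Kt = (\<chi> x y. K $ x $ (inv g y))"
  shows "kernel_prod Ks n $ x $ z = kernel_power Kt n $ x $ (g ^^ n) z"
proof (induction n arbitrary: z)
  case 0
  then show ?case by simp
next
  case (Suc n)
  \<comment> \<open>The extra \<open>g\<close> in the column index is undone by the
    \<open>inv g\<close> in \<open>Kt\<close>.\<close>
  have "Ks (Suc n) $ y $ z = Kt $ (g ^^ n) y $ (g ^^ Suc n) z" for y
    using g by (simp add: Ks Kt bij_is_inj)
  then have "kernel_prod Ks (Suc n) $ x $ z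
      = (\<Sum>y\<in>UNIV. kernel_power Kt n $ x $ (g ^^ n) y * Kt $ (g ^^ n) y $ (g ^^ Suc n) z)"
    by (simp add: matrix_mult_component Suc)
  \<comment> \<open>Both factors see the intermediate state only as \<open>(g ^^ n) y\<close>, so
    the twist disappears by reindexing the sum.\<close>
  also have "\<dots> = (\<Sum>y\<in>UNIV. kernel_power Kt n $ x $ y * Kt $ y $ (g ^^ Suc n) z)"
    by (rule sum.reindex_bij_betw) (simp add: bij_fn g)
  finally show ?case by (simp add: kernel_power_Suc matrix_mult_component)
qed

theorem theorem3p6:
  fixes K Kt :: "real^'v^'v" and g :: "'v \<Rightarrow> 'v" and Ks :: "nat \<Rightarrow> real^'v^'v"
  assumes "markov_kernel K"
    and "bij g"
    and "\<And>i. i \<ge> 1 \<Longrightarrow> Ks i = (\<chi> x y. K $ ((g ^^ (i - 1)) x) $ ((g ^^ (i - 1)) y))"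
    and "Kt = (\<chi> x y. K $ x $ (inv g y))"
  shows "(merging_rel_sup Ks \<longleftrightarrow> irreducible_kernel Kt \<and> aperiodic_kernel Kt) \<and>
    (irreducible_kernel Kt \<and> aperiodic_kernel Kt \<longrightarrow>
      (\<exists>!p. invariant_prob Kt p) \<and>
      (\<forall>p. invariant_prob Kt p \<longrightarrow>
        (let \<mu> = (\<lambda>i. \<chi> x. p $ ((g ^^ i) x)) :: nat \<Rightarrow> real^'v;
             \<sigma>\<^sub>1 = singular_values p Kt ! 1
         in \<forall>n\<ge>1. \<forall>x z.
              \<bar>kernel_prod Ks n $ x $ z / \<mu> n $ z - 1\<bar>
                \<le> sqrt (1 / p $ x - 1) * sqrt (1 / p $ ((g ^^ n) z) - 1) * \<sigma>\<^sub>1 ^ n)))"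
proof (intro conjI impI)
  note shift = kernel_prod_shifted[OF assms(2-4)]
  \<comment> \<open>Each row of \<open>Kt\<close> is a permuted row of \<open>K\<close>, so
    \<open>Kt\<close> is again a Markov kernel.\<close>
  have "(\<Sum>y\<in>UNIV. K $ x $ inv g y) = (\<Sum>y\<in>UNIV. K $ x $ y)" for x
    by (rule sum.reindex_bij_betw) (simp add: assms(2) bij_imp_bij_inv)
  then have Kt: "markov_kernel Kt" using assms(1) by (simp add: markov_kernel_def assms(4))
  have "rel_sup_dist (kernel_prod Ks n) = rel_sup_dist (kernel_power Kt n)" for n
    by (rule rel_sup_dist_permute_columns[of "g ^^ n"]) (simp_all add: assms(2) bij_fn shift)
  then have "merging_rel_sup Ks \<longleftrightarrow> merging_rel_sup (\<lambda>_. Kt)"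
    by (simp add: merging_rel_sup_def kernel_power_def)
  then show "merging_rel_sup Ks \<longleftrightarrow> irreducible_kernel Kt \<and> aperiodic_kernel Kt"
    by (simp add: merging_rel_sup_iff Kt)
  assume "irreducible_kernel Kt \<and> aperiodic_kernel Kt"
  then obtain N where N: "\<And>n x y. n \<ge> N \<Longrightarrow> kernel_power Kt n $ x $ y > 0"
    using irreducible_aperiodic_imp_eventually_pos Kt by metis
  obtain q where q: "\<And>z. q $ z > 0" and lim: "\<And>x z. (\<lambda>n. kernel_power Kt n $ x $ z) \<longlonglongrightarrow> q $ z"
    using kernel_power_tendsto_pos[OF Kt N] by blast
  note invariant = invariant_prob_limit[OF Kt lim]
  show "\<exists>!p. invariant_prob Kt p" using invariant by blast
  show "\<forall>p. invariant_prob Kt p \<longrightarrow>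
      (let \<mu> = (\<lambda>i. \<chi> x. p $ ((g ^^ i) x)) :: nat \<Rightarrow> real^'v;
           \<sigma>\<^sub>1 = singular_values p Kt ! 1
       in \<forall>n\<ge>1. \<forall>x z.
            \<bar>kernel_prod Ks n $ x $ z / \<mu> n $ z - 1\<bar>
              \<le> sqrt (1 / p $ x - 1) * sqrt (1 / p $ ((g ^^ n) z) - 1) * \<sigma>\<^sub>1 ^ n)"
  proof (intro allI impI)
    fix p assume "invariant_prob Kt p"
    then have [simp]: "p = q" by (rule invariant(2))
    show "let \<mu> = (\<lambda>i. \<chi> x. p $ ((g ^^ i) x)) :: nat \<Rightarrow> real^'v;
           \<sigma>\<^sub>1 = singular_values p Kt ! 1
       in \<forall>n\<ge>1. \<forall>x z.
            \<bar>kernel_prod Ks n $ x $ z / \<mu> n $ z - 1\<bar>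
              \<le> sqrt (1 / p $ x - 1) * sqrt (1 / p $ ((g ^^ n) z) - 1) * \<sigma>\<^sub>1 ^ n"
      \<comment> \<open>The bound for powers is read at \<open>w = (g ^^ n) z\<close>, where
        \<open>p $ w\<close> is the value of the shifted measure at \<open>z\<close>.\<close>
      using kernel_power_ratio_bound[OF Kt invariant(1) q] by (simp add: Let_def shift)
  qed
qed

end
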